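(* The mixed integer program $(Q)$ defined in the context is only approximate in finding an optimal piecewise affine fitting function, i.e. the identity $f(z)=w(z)$ between its fitting variables and a function $f$ that is affine on each segment does not hold in general. That is, there exist integers $m,n\ge1$, a matrix $Y=(y_{i,j})\in\mathbb{R}^{m\times n}$ and $\lambda\in(0,1)$ such that, for sufficiently large $M$, problem $(Q)$ has an optimal solution $(w^\star,x^\star)$ with the following property: there is a segment $S$ of the segmentation defined by $x^\star$ for which no affine function $f(z_1,z_2)=az_1+bz_2+c$ with $a,b,c\in\mathbb{R}$ satisfies $w^\star_{i,j}=f(i,j)$ for all $(i,j)\in S$.
   Context: Let $G=(V,E)$ be the $m\times n$ grid graph: $V=\{(i,j):1\le i\le m,\ 1\le j\le n\}$ and $E=E^r\cup E^c$, where $E^r$ consists of the row edges $e^r_{i,j}=\{(i,j),(i,j+1)\}$ and $E^c$ of the column edges $e^c_{i,j}=\{(i,j),(i+1,j)\}$. Write $x^r_{i,j}:=x_{e^r_{i,j}}$ and $x^c_{i,j}:=x_{e^c_{i,j}}$. For $w=(w_{i,j})\in\mathbb{R}^{m\times n}$ put $\nabla_r^2 w_{i,j}=w_{i,j-1}-2w_{i,j}+w_{i,j+1}$ and $\nabla_c^2 w_{i,j}=w_{i-1,j}-2w_{i,j}+w_{i+1,j}$. Problem $(Q)$, with data $Y=(y_{i,j})\in\mathbb{R}^{m\times n}$, regularization parameter $\lambda$ and big-$M$ constant $M>0$, is $$\min_{w,x}\ (1-\lambda)\sum_{i=1}^m\sum_{j=1}^n|w_{i,j}-y_{i,j}|+\lambda\sum_{e\in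 E}x_e$$ subject to $|\nabla_r^2 w_{i,j}|\le M(x^r_{i,j-1}+x^r_{i,j})$ for $1\le i\le m$, $2\le j\le n-1$; $|\nabla_c^2 w_{i,j}|\le M(x^c_{i-1,j}+x^c_{i,j})$ for $1\le j\le n$, $2\le i\le m-1$; $\sum_{e\in C\setminus\{e'\}}x_e\ge x_{e'}$ for all cycles $C\subseteq E$ (regarded as edge sets) and all $e'\in C$; $w_{i,j}\in\mathbb{R}$ for all $i,j$; $x_e\in\{0,1\}$ for all $e\in E$. The segmentation defined by a feasible $x$ is the partition of $V$ into the connected components of the graph obtained from $G$ by deleting all edges $e$ with $x_e=1$; these components are called segments. A function on $V$ is piecewise affine with respect to this partition if its restriction to each segment is the restriction of an affine function of the coordinates $(z_1,z_2)=(i,j)$. *)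

theory Defs
  imports Complex_Main
begin

type_synonym vertex = "nat \<times> nat"
type_synonym edge = "vertex set"

definition grid_vertices :: "nat \<Rightarrow> nat \<Rightarrow> vertex set" where
  "grid_vertices m n = {1..m} \<times> {1..n}"

definition row_edge :: "nat \<Rightarrow> nat \<Rightarrow> edge" where
  "row_edge i j = {(i, j), (i, j + 1)}"

definition col_edge :: "nat \<Rightarrow> nat \<Rightarrow> edge" where
  "col_edge i j = {(i, j), (i + 1, j)}"

definition row_edges :: "nat \<Rightarrow> nat \<Rightarrow> edge set" where
  "row_edges m n = {row_edge i j | i j. i \<in> {1..m} \<and> j \<in> {1..<n}}"

definition col_edges :: "nat \<Rightarrow> nat \<Rightarrow> edge set" where
  "col_edges m n = {col_edge i j | i j. i \<in> {1..<m} \<and> j \<in> {1..n}}"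

definition grid_edges :: "nat \<Rightarrow> nat \<Rightarrow> edge set" where
  "grid_edges m n = row_edges m n \<union> col_edges m n"

definition cycle_edges :: "'a list \<Rightarrow> 'a set set" where
  "cycle_edges vs = {{vs ! k, vs ! (Suc k mod length vs)} | k. k < length vs}"

definition is_cycle :: "'a set set \<Rightarrow> 'a set set \<Rightarrow> bool" where
  "is_cycle F C \<longleftrightarrow>
     (\<exists>vs. 3 \<le> length vs \<and> distinct vs \<and> C = cycle_edges vs \<and> C \<subseteq> F)"

text \<open>The vertex sets of the connected components of the graph with vertex set \<open>V\<close> and
  (two-element) edges \<open>F\<close>.\<close>

definition connected_components :: "'a set \<Rightarrow> 'a set set \<Rightarrow> 'a set set" where
  "connected_components V F =
     V // {(u, v). u \<in> V \<and> v \<in> V \<and> (u, v) \<in> {(a, b). {a, b} \<in> F}\<^sup>*}"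

definition row_diff2 :: "(nat \<Rightarrow> nat \<Rightarrow> real) \<Rightarrow> nat \<Rightarrow> nat \<Rightarrow> real" where
  "row_diff2 w i j = w i (j - 1) - 2 * w i j + w i (j + 1)"

definition col_diff2 :: "(nat \<Rightarrow> nat \<Rightarrow> real) \<Rightarrow> nat \<Rightarrow> nat \<Rightarrow> real" where
  "col_diff2 w i j = w (i - 1) j - 2 * w i j + w (i + 1) j"

text \<open>Matrices and edge variables are total functions. Only the entries with
  \<open>1 \<le> i \<le> m\<close>, \<open>1 \<le> j \<le> n\<close> and the edges in \<open>grid_edges m n\<close> occur in the
  constraints and in the objective; all other values are irrelevant.\<close>

definition feasible ::
  "nat \<Rightarrow> nat \<Rightarrow> real \<Rightarrow> (nat \<Rightarrow> nat \<Rightarrow> real) \<Rightarrow> (edge \<Rightarrow> real) \<Rightarrow> bool" where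
  "feasible m n M w x \<longleftrightarrow>
     (\<forall>i\<in>{1..m}. \<forall>j\<in>{2..n - 1}.
        \<bar>row_diff2 w i j\<bar> \<le> M * (x (row_edge i (j - 1)) + x (row_edge i j))) \<and>
     (\<forall>j\<in>{1..n}. \<forall>i\<in>{2..m - 1}.
        \<bar>col_diff2 w i j\<bar> \<le> M * (x (col_edge (i - 1) j) + x (col_edge i j))) \<and>
     (\<forall>C. is_cycle (grid_edges m n) C \<longrightarrow> (\<forall>e'\<in>C. (\<Sum>e\<in>C - {e'}. x e) \<ge> x e')) \<and>
     (\<forall>e\<in>grid_edges m n. x e \<in> {0, 1})"

definition objective ::
  "nat \<Rightarrow> nat \<Rightarrow> (nat \<Rightarrow> nat \<Rightarrow> real) \<Rightarrow> real \<Rightarrow>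
   (nat \<Rightarrow> nat \<Rightarrow> real) \<Rightarrow> (edge \<Rightarrow> real) \<Rightarrow> real" where
  "objective m n Y lam w x =
     (1 - lam) * (\<Sum>i=1..m. \<Sum>j=1..n. \<bar>w i j - Y i j\<bar>) + lam * (\<Sum>e\<in>grid_edges m n. x e)"

definition optimal_solution ::
  "nat \<Rightarrow> nat \<Rightarrow> (nat \<Rightarrow> nat \<Rightarrow> real) \<Rightarrow> real \<Rightarrow> real \<Rightarrow>
   (nat \<Rightarrow> nat \<Rightarrow> real) \<Rightarrow> (edge \<Rightarrow> real) \<Rightarrow> bool" where
  "optimal_solution m n Y lam M w x \<longleftrightarrow>
     feasible m n M w x \<and>
     (\<forall>w' x'. feasible m n M w' x' \<longrightarrow> objective m n Y lam w x \<le> objective m n Y lam w' x')"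

definition segments :: "nat \<Rightarrow> nat \<Rightarrow> (edge \<Rightarrow> real) \<Rightarrow> vertex set set" where
  "segments m n x =
     connected_components (grid_vertices m n) (grid_edges m n - {e. x e = 1})"

definition affine_on :: "vertex set \<Rightarrow> (nat \<Rightarrow> nat \<Rightarrow> real) \<Rightarrow> bool" where
  "affine_on S w \<longleftrightarrow>
     (\<exists>a b c :: real. \<forall>(i, j)\<in>S. w i j = a * real i + b * real j + c)"

end

theory Submission
  imports Defs
begin

text \<open>The constraints of the program bound only the pure second differences of \<open>w\<close>, along
  rows and along columns; nothing controls the mixed difference
  \<open>w i j - w (i + 1) j - w i (j + 1) + w (i + 1) (j + 1)\<close>. The bilinear function
  \<open>w i j = i * j\<close> is affine along every row and every column, but its mixed difference is
  \<open>1\<close>, so it is not affine in two variables.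

  Hence, for the data \<open>Y i j = i * j\<close>, the exact fit \<open>w = Y\<close> without any cut edge
  is feasible and costs \<open>0\<close>. No feasible solution costs less, because the edge variables
  are \<open>0\<close> or \<open>1\<close>, so this solution is optimal for every \<open>M\<close> and every
  \<open>\<lambda>\<close> in the unit interval. Its only segment is the whole grid, and the fit is not
  affine on a segment containing a unit square.

  Any grid with at least two rows and two columns would do. The theorem uses the
  \<open>3 \<times> 3\<close> grid, the smallest one on which both families of second-difference
  constraints are nonempty, so that the phenomenon does not come from their absence.\<close>

definition bilinear :: "nat \<Rightarrow> nat \<Rightarrow> real" where
  "bilinear i j = real i * real j"

lemma row_diff2_bilinear: "1 \<le> j \<Longrightarrow> row_diff2 bilinear i j = 0"
  by (simp add: row_diff2_def bilinear_def algebra_simps)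

lemma col_diff2_bilinear: "1 \<le> i \<Longrightarrow> col_diff2 bilinear i j = 0"
  by (simp add: col_diff2_def bilinear_def algebra_simps)

lemma feasible_bilinear: "feasible m n M bilinear (\<lambda>_. 0)"
  by (simp add: feasible_def row_diff2_bilinear col_diff2_bilinear)

lemma objective_nonneg:
  assumes "0 \<le> lam" "lam \<le> 1" "feasible m n M w x"
  shows "0 \<le> objective m n Y lam w x"
proof -
  have "x e \<ge> 0" if "e \<in> grid_edges m n" for e
    using assms(3) that by (auto simp: feasible_def)
  then show ?thesis
    using assms(1,2) unfolding objective_def
    by (intro add_nonneg_nonneg mult_nonneg_nonneg sum_nonneg) auto
qed

lemma exact_fit_without_cuts_optimal:
  assumes "0 \<le> lam" "lam \<le> 1" "feasible m n M Y (\<lambda>_. 0)"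
  shows "optimal_solution m n Y lam M Y (\<lambda>_. 0)"
proof -
  have "objective m n Y lam Y (\<lambda>_. 0) = 0"
    by (simp add: objective_def)
  then show ?thesis
    using assms objective_nonneg by (simp add: optimal_solution_def)
qed

lemma row_edge_in_grid_edges:
  "i \<in> {1..m} \<Longrightarrow> j \<in> {1..<n} \<Longrightarrow> row_edge i j \<in> grid_edges m n"
  unfolding grid_edges_def row_edges_def by blast

lemma col_edge_in_grid_edges:
  "i \<in> {1..<m} \<Longrightarrow> j \<in> {1..n} \<Longrightarrow> col_edge i j \<in> grid_edges m n"
  unfolding grid_edges_def col_edges_def by blast

text \<open>The two edges at \<open>(1, 1)\<close> and the edge from \<open>(1, 2)\<close> to \<open>(2, 2)\<close> already
  connect the corner square. The rest of the grid belongs to the same segment, but the square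
  is enough to detect a nonzero mixed difference.\<close>

lemma corner_square_in_segment:
  assumes "2 \<le> m" "2 \<le> n"
  obtains S where "S \<in> segments m n (\<lambda>_. 0)" "{1, 2} \<times> {1, 2} \<subseteq> S"
proof -
  let ?V = "grid_vertices m n"
  let ?R = "{(a, b). {a, b} \<in> grid_edges m n}"
  let ?C = "{(u, v). u \<in> ?V \<and> v \<in> ?V \<and> (u, v) \<in> ?R\<^sup>*}"
  have V: "{1, 2} \<times> {1, 2} \<subseteq> ?V"
    using assms by (auto simp: grid_vertices_def)
  have "row_edge 1 1 \<in> grid_edges m n" "col_edge 1 1 \<in> grid_edges m n"
    "col_edge 1 2 \<in> grid_edges m n"
    using assms by (auto intro: row_edge_in_grid_edges col_edge_in_grid_edges)
  then have R: "((1, 1), (1, 2)) \<in> ?R" "((1, 1), (2, 1)) \<in> ?R" "((1, 2), (2, 2)) \<in> ?R"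
    by (simp_all add: row_edge_def col_edge_def numeral_2_eq_2)
  have reach: "((1, 1), v) \<in> ?R\<^sup>*" if "v \<in> {1, 2} \<times> {1, 2}" for v
  proof -
    have "v \<in> {(1, 1), (1, 2), (2, 1), (2, 2)}"
      using that by auto
    moreover have "((1, 1), (2, 2)) \<in> ?R\<^sup>*"
      using R(1,3) by (rule r_into_rtrancl[THEN rtrancl_into_rtrancl])
    ultimately show ?thesis
      using R(1,2)[THEN r_into_rtrancl] by (elim insertE emptyE)
        (simp_all only: rtrancl.rtrancl_refl)
  qed
  show thesis
  proof
    have "segments m n (\<lambda>_. 0) = ?V // ?C"
      by (simp add: segments_def connected_components_def)
    moreover have "(1, 1) \<in> ?V"
      using V by blast
    ultimately show "?C `` {(1, 1)} \<in> segments m n (\<lambda>_. 0)"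
      by (simp only: quotientI)
    show "{1, 2} \<times> {1, 2} \<subseteq> ?C `` {(1, 1)}"
      using V reach by blast
  qed
qed

lemma affine_on_unit_square_mixed_difference:
  assumes "affine_on S w" "{i, i + 1} \<times> {j, j + 1} \<subseteq> S"
  shows "w i j - w (i + 1) j - w i (j + 1) + w (i + 1) (j + 1) = 0"
proof -
  obtain a b c where "\<forall>(k, l)\<in>S. w k l = a * real k + b * real l + c"
    using assms(1) by (auto simp: affine_on_def)
  then have w: "w k l = a * real k + b * real l + c"
    if "(k, l) \<in> {i, i + 1} \<times> {j, j + 1}" for k l
    using assms(2) that by blast
  show ?thesis
    by (simp add: w algebra_simps)
qed

lemma bilinear_not_affine_on_corner_square:
  assumes "{1, 2} \<times> {1, 2} \<subseteq> S"
  shows "\<not> affine_on S bilinear"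
proof
  assume "affine_on S bilinear"
  from affine_on_unit_square_mixed_difference[OF this, of 1 1] assms show False
    by (simp add: bilinear_def numeral_2_eq_2)
qed

theorem theorem1:
  "\<exists>(m::nat) (n::nat) (Y :: nat \<Rightarrow> nat \<Rightarrow> real) (lam::real).
     m \<ge> 1 \<and> n \<ge> 1 \<and> 0 < lam \<and> lam < 1 \<and>
     (\<exists>M0>0. \<forall>M\<ge>M0.
        \<exists>w x. optimal_solution m n Y lam M w x \<and>
          (\<exists>S\<in>segments m n x. \<not> affine_on S w))"
proof -
  have opt: "optimal_solution 3 3 bilinear (1/2) M bilinear (\<lambda>_. 0)" for M
    by (rule exact_fit_without_cuts_optimal) (simp_all add: feasible_bilinear)
  obtain S where "S \<in> segments 3 3 (\<lambda>_. 0)" "{1, 2} \<times> {1, 2} \<subseteq> S"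
    by (rule corner_square_in_segment[of 3 3]) auto
  then have "\<exists>S\<in>segments 3 3 (\<lambda>_. 0). \<not> affine_on S bilinear"
    using bilinear_not_affine_on_corner_square by blast
  with opt have "\<exists>w x. optimal_solution 3 3 bilinear (1/2) M w x \<and>
      (\<exists>S\<in>segments 3 3 x. \<not> affine_on S w)" for M
    by blast
  then have "\<exists>M0>0. \<forall>M\<ge>M0. \<exists>w x. optimal_solution 3 3 bilinear (1/2) M w x \<and>
      (\<exists>S\<in>segments 3 3 x. \<not> affine_on S w)"
    by (intro exI[of _ 1]) simp
  then show ?thesis
    by - (rule exI[of _ 3], rule exI[of _ 3], rule exI[of _ bilinear], rule exI[of _ "1/2"], simp)
qed

end
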